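(* Let $n\ge1$ and let $\alpha_1\ge\dots\ge\alpha_n\ge0$ be real numbers. Then $$\mathrm{vol}_n(\Lambda(\alpha_1,\dots,\alpha_n))=\frac1{n!}\sum_{k\in[n]}\ \sum_{L\in\binom{[n]}{k}}\ \sum_{\sigma\in\mathrm{Sym}(k)}\frac{\langle\sigma(L),\alpha^{[k]}\rangle^n}{\sigma(L)_k\cdot\prod_{i\in[k-1]}\bigl(\sigma(L)_i-\sigma(L)_{i+1}\bigr)\cdot\prod_{i\in[n]\setminus L}(-i)},$$ where $\alpha^{[k]}=(\alpha_1,\dots,\alpha_k)$, each $L\in\binom{[n]}{k}$ is sorted ascendingly to obtain a vector in $\mathbb{R}^k$, and $\sigma(L)$ is the vector obtained from it by permuting the coordinates by $\sigma$.
   Context: $[n]=\{1,\dots,n\}$, $[0]=\emptyset$, and $\binom{[n]}{k}$ is the set of $k$-element subsets of $[n]$; empty products equal $1$; $\langle\cdot,\cdot\rangle$ is the standard scalar product. The SIM-body is $$\Lambda(\alpha_1,\dots,\alpha_n)=\Bigl\{x\in\mathbb{R}^n_{\ge0}\ \Big|\ \sum_{i\in I}x_i\le\alpha_1+\dots+\alpha_k\text{ for all }I\in\tbinom{[n]}{k},\ k\ge1\Bigr\}.$$ *)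

theory Defs
  imports
    "HOL-Analysis.Analysis"
    "HOL-Combinatorics.Permutations"
    "HOL-Library.Ramsey"
begin

(* Vectors in R^n are extensional functions on the index set {1..n}, so that n is an
   ordinary natural number; lebesgue_n is then the Lebesgue measure on R^n (the library's
   lborel on a Euclidean space is the image of the same product measure over its basis). *)

abbreviation lebesgue_n :: "nat \<Rightarrow> (nat \<Rightarrow> real) measure" where
  "lebesgue_n n \<equiv> \<Pi>\<^sub>M i\<in>{1..n}. lborel"

abbreviation vol :: "nat \<Rightarrow> (nat \<Rightarrow> real) set \<Rightarrow> real" where
  "vol n \<equiv> measure (lebesgue_n n)"

(* nsets A k is the set of k-element subsets of A. *)

definition sim_body :: "nat \<Rightarrow> (nat \<Rightarrow> real) \<Rightarrow> (nat \<Rightarrow> real) set" where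
  "sim_body n \<alpha> =
     {x \<in> {1..n} \<rightarrow>\<^sub>E {0..}.
        \<forall>k\<ge>1. \<forall>I\<in>nsets {1..n} k. (\<Sum>i\<in>I. x i) \<le> (\<Sum>i=1..k. \<alpha> i)}"

(* sigma(L): coordinates are numbered from 1 while list positions start at 0. The convention
   is sigma(L)_i = L_(sigma i); the other one replaces sigma by its inverse, which does not
   affect a sum over all permutations. *)

definition perm_vec :: "(nat \<Rightarrow> nat) \<Rightarrow> nat set \<Rightarrow> nat \<Rightarrow> real" where
  "perm_vec \<sigma> L i = real (sorted_list_of_set L ! (\<sigma> i - 1))"

end

theory Submission
  imports Defs "HOL-Library.More_List" "HOL-Combinatorics.Multiset_Permutations"
begin

text \<open>
  The formula is a Brion-type sum over the vertices of the polytope \<open>\<Lambda>(\<alpha>)\<close>. For generic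
  \<open>\<alpha>\<close> a vertex is given by a list \<open>w = (w\<^sub>1, \<dots>, w\<^sub>k)\<close> of distinct indices: coordinate
  \<open>w\<^sub>i\<close> has the value \<open>\<alpha>\<^sub>i\<close> and all other coordinates are 0. The edges at this vertex
  have the directions \<open>e(w\<^sub>i\<^sub>+\<^sub>1) - e(w\<^sub>i)\<close> (exchange two neighbouring values), \<open>- e(w\<^sub>k)\<close>
  (lower the last value) and \<open>e(i)\<close> for \<open>i\<close> outside \<open>w\<close>. For a linear form
  \<open>c(x) = \<Sum> c\<^sub>i x\<^sub>i\<close> that is constant on no edge, Brion's theorem predicts

  \<open>\<integral> (a + c(x))^p / p! dx = \<Sum>\<^sub>w (a + c(v\<^sub>w))^(p+n) / (p+n)! / D(w)\<close>,

  the integral being taken over \<open>\<Lambda>(\<alpha>)\<close>, where \<open>v\<^sub>w\<close> is the vertex of \<open>w\<close> and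
  \<open>D(w)\<close> is the product of \<open>- c(u)\<close> over the edge directions \<open>u\<close> at \<open>v\<^sub>w\<close>. The volume
  is the case \<open>p = a = 0\<close>, and \<open>c\<^sub>i = i\<close> gives the stated denominators. The empty list,
  the vertex 0, contributes nothing for \<open>a = 0\<close>.

  The displayed identity (\<open>nn_integral_linear_power_sim_body\<close>) is proved by induction on the
  dimension. The offset \<open>a\<close> is there for the induction: fixing the last coordinate to \<open>t\<close>
  adds \<open>c\<^sub>n t\<close> to it. Put \<open>\<alpha>\<^sub>n\<^sub>+\<^sub>1 = 0\<close>. If \<open>\<alpha>\<^sub>j\<^sub>+\<^sub>1 \<le> t \<le> \<alpha>\<^sub>j\<close>, the slice \<open>x\<^sub>n = t\<close>
  of \<open>\<Lambda>(\<alpha>)\<close> is again a body of the same kind, with the two neighbours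
  \<open>\<alpha>\<^sub>j, \<alpha>\<^sub>j\<^sub>+\<^sub>1\<close> of \<open>t\<close> replaced by the single parameter \<open>\<alpha>\<^sub>j + \<alpha>\<^sub>j\<^sub>+\<^sub>1 - t\<close>
  (\<open>sim_body_slice\<close>). So \<open>t\<close> runs through finitely many intervals, and on each of them the
  induction hypothesis gives a polynomial in \<open>t\<close> whose terms are powers of affine functions.
  At the endpoints of its interval, an antiderivative of the term of \<open>w\<close> takes the values that
  belong to \<open>w\<close> with \<open>n\<close> inserted just before and just after the entry \<open>w\<^sub>j\<close>, where \<open>w\<close>
  is thought of as continued by entries of weight 0. An inserted list thus receives contributions
  from the intervals that end at its value of \<open>t\<close>, and their coefficients add up by a partial
  fraction identity (\<open>chain_prod_insert_at\<close>) to the coefficient that the formula in dimension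
  \<open>n\<close> prescribes (\<open>vertex_sum_Suc\<close>).
\<close>

section \<open>Lists of distinct indices and insertion of an entry\<close>

text \<open>
  The entry at list position \<open>i\<close>, counted from 0, is paired with \<open>\<alpha> (Suc i)\<close>, since
  parameters are numbered from 1. For \<open>vs = map c w\<close> this is the value of the linear form with
  weights \<open>c\<close> at the vertex of \<open>w\<close>.
\<close>

definition pairing :: "(nat \<Rightarrow> real) \<Rightarrow> real list \<Rightarrow> real" where
  "pairing \<alpha> vs = (\<Sum>i<length vs. vs ! i * \<alpha> (Suc i))"

text \<open>
  The list is continued by 0, so that the last factor is the last entry itself: lowering the last
  positive coordinate of a vertex to 0 is treated like an exchange with a coordinate of weight 0.
\<close>

definition chain_prod :: "real list \<Rightarrow> real" where
  "chain_prod vs = (\<Prod>i<length vs. vs ! i - nth_default 0 vs (Suc i))"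

definition insert_at :: "nat \<Rightarrow> 'a \<Rightarrow> 'a list \<Rightarrow> 'a list" where
  "insert_at j x xs = take j xs @ x # drop j xs"

lemma mset_insert_at: "mset (insert_at j x xs) = add_mset x (mset xs)"
proof -
  have "mset (take j xs) + mset (drop j xs) = mset xs"
    by (metis append_take_drop_id mset_append)
  then show ?thesis by (simp add: insert_at_def)
qed

lemma set_insert_at: "set (insert_at j x xs) = insert x (set xs)"
  using arg_cong[OF mset_insert_at, of set_mset] by simp

lemma distinct_insert_at: "distinct (insert_at j x xs) \<longleftrightarrow> distinct (x # xs)"
  by (rule mset_eq_imp_distinct_iff) (simp add: mset_insert_at)

text \<open>
  These are the parameters left for the other entries when an entry inserted at list position
  \<open>j\<close> uses up \<open>\<alpha> (Suc j)\<close>.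
\<close>

definition skip :: "nat \<Rightarrow> (nat \<Rightarrow> 'a) \<Rightarrow> nat \<Rightarrow> 'a" where
  "skip j \<alpha> i = (if i \<le> j then \<alpha> i else \<alpha> (Suc i))"

lemma pairing_Nil [simp]: "pairing \<alpha> [] = 0"
  by (simp add: pairing_def)

lemma pairing_Cons: "pairing \<alpha> (v # vs) = v * \<alpha> 1 + pairing (\<lambda>i. \<alpha> (Suc i)) vs"
  unfolding pairing_def by (simp add: sum.lessThan_Suc_shift del: sum.lessThan_Suc)

lemma pairing_cong:
  assumes "\<And>i. i \<in> {1..length vs} \<Longrightarrow> \<alpha> i = \<beta> i"
  shows "pairing \<alpha> vs = pairing \<beta> vs"
  unfolding pairing_def using assms by (intro sum.cong) auto

lemma pairing_fun_upd:
  "pairing (\<alpha>(Suc j := y)) vs = pairing \<alpha> vs + nth_default 0 vs j * (y - \<alpha> (Suc j))"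
proof (cases "j < length vs")
  case True
  have "pairing (\<alpha>(Suc j := y)) vs - pairing \<alpha> vs
      = (\<Sum>i<length vs. vs ! i * ((\<alpha>(Suc j := y)) (Suc i) - \<alpha> (Suc i)))"
    unfolding pairing_def by (simp add: sum_subtractf algebra_simps)
  also have "\<dots> = (\<Sum>i<length vs. if i = j then vs ! j * (y - \<alpha> (Suc j)) else 0)"
    by (intro sum.cong) auto
  also have "\<dots> = vs ! j * (y - \<alpha> (Suc j))"
    using True by simp
  finally show ?thesis
    using True by (simp add: nth_default_def)
next
  case False
  then show ?thesis
    by (auto simp: nth_default_def pairing_def intro!: sum.cong)
qed

lemma pairing_insert_at:
  "j \<le> length vs \<Longrightarrow>
    pairing \<alpha> (insert_at j c vs) = c * \<alpha> (Suc j) + pairing (skip j \<alpha>) vs"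
proof (induction vs arbitrary: j \<alpha>)
  case Nil
  then show ?case by (simp add: insert_at_def pairing_Cons)
next
  case (Cons v vs)
  show ?case
  proof (cases j)
    case 0
    have "pairing (skip 0 \<alpha>) (v # vs) = pairing (\<lambda>i. \<alpha> (Suc i)) (v # vs)"
      by (rule pairing_cong) (auto simp: skip_def)
    with 0 show ?thesis by (simp add: insert_at_def pairing_Cons)
  next
    case (Suc j')
    have "pairing (\<lambda>i. skip j \<alpha> (Suc i)) vs = pairing (skip j' (\<lambda>i. \<alpha> (Suc i))) vs"
      by (rule pairing_cong) (auto simp: skip_def Suc)
    moreover have "skip j \<alpha> 1 = \<alpha> 1" by (simp add: skip_def Suc)
    ultimately show ?thesis
      using Cons.IH[of j' "\<lambda>i. \<alpha> (Suc i)"] Cons.prems Suc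
      by (simp add: insert_at_def pairing_Cons)
  qed
qed

lemma chain_prod_Nil [simp]: "chain_prod [] = 1"
  by (simp add: chain_prod_def)

lemma chain_prod_Cons:
  "chain_prod (v # vs) = (v - nth_default 0 vs 0) * chain_prod vs"
  unfolding chain_prod_def
  by (simp add: prod.lessThan_Suc_shift del: prod.lessThan_Suc)

lemma chain_prod_nonzero:
  "distinct vs \<Longrightarrow> 0 \<notin> set vs \<Longrightarrow> chain_prod vs \<noteq> 0"
proof (induction vs)
  case (Cons v vs)
  then show ?case
    by (cases vs) (auto simp: chain_prod_Cons)
qed simp

text \<open>
  Inserting \<open>c\<close> between neighbours \<open>u\<close> and \<open>v\<close> replaces the factor \<open>u - v\<close> by
  \<open>(u - c) (c - v)\<close>, and \<open>(u - v) / ((u - c) (c - v)) = 1 / (c - v) - 1 / (c - u)\<close>. The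
  two fractions are the factors that integration produces on the two intervals meeting at the
  corresponding parameter.
\<close>

lemma chain_prod_insert_at:
  assumes "distinct (c # vs)" "0 \<notin> set (c # vs)" "j \<le> length vs"
  shows "chain_prod vs / chain_prod (insert_at j c vs) =
    (if j = 0 then 1 / (c - nth_default 0 vs 0)
     else 1 / (c - nth_default 0 vs j) - 1 / (c - nth_default 0 vs (j - 1)))"
  using assms
proof (induction vs arbitrary: j)
  case Nil
  then show ?case by (simp add: insert_at_def chain_prod_Cons)
next
  case (Cons v vs)
  have "chain_prod vs \<noteq> 0"
    using Cons.prems by (intro chain_prod_nonzero) auto
  then have nz: "chain_prod vs \<noteq> 0" "c \<noteq> v" "v \<noteq> nth_default 0 vs 0" "c \<noteq> nth_default 0 vs 0"
    using Cons.prems by (auto simp: nth_default_def)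
  consider "j = 0" | "j = 1" | i where "j = Suc (Suc i)"
    by (metis One_nat_def not0_implies_Suc)
  then show ?case
  proof cases
    case 1
    then show ?thesis using nz by (simp add: insert_at_def chain_prod_Cons)
  next
    case 2
    then show ?thesis
      using nz by (simp add: insert_at_def chain_prod_Cons divide_simps) (simp add: algebra_simps)
  next
    case 3
    then obtain y ys where vs: "vs = y # ys"
      using Cons.prems by (cases vs) auto
    have head: "nth_default 0 (insert_at (Suc i) c vs) 0 = nth_default 0 vs 0"
      by (simp add: insert_at_def vs)
    have "chain_prod (v # vs) / chain_prod (insert_at j c (v # vs))
        = chain_prod vs / chain_prod (insert_at (Suc i) c vs)"
      using head nz by (simp add: 3 insert_at_def chain_prod_Cons)
    also have "\<dots> = 1 / (c - nth_default 0 vs (Suc i)) - 1 / (c - nth_default 0 vs i)"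
      using Cons.IH[of "Suc i"] Cons.prems 3 by simp
    finally show ?thesis by (simp add: 3)
  qed
qed

lemma summation_by_parts:
  fixes f q :: "nat \<Rightarrow> real"
  shows "(\<Sum>j\<le>m. (f j - f (Suc j)) * q j) =
    (\<Sum>j\<le>m. f j * (if j = 0 then q 0 else q j - q (j - 1))) - f (Suc m) * q m"
  by (induction m) (auto simp: algebra_simps)

section \<open>The sum over the vertices and its recursion in the dimension\<close>

definition arrangements :: "nat \<Rightarrow> nat list set" where
  "arrangements n = {w. distinct w \<and> set w \<subseteq> {1..n}}"

lemma finite_arrangements [simp]: "finite (arrangements n)"
  using finite_subset_distinct[of "{1..n}"] by (simp add: arrangements_def conj_commute)

lemma arrangements_0 [simp]: "arrangements 0 = {[]}"
  by (auto simp: arrangements_def)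

lemma length_arrangement: "w \<in> arrangements n \<Longrightarrow> length w \<le> n"
  unfolding arrangements_def
  by (metis (mono_tags, lifting) card_atLeastAtMost card_mono diff_Suc_1 distinct_card
      finite_atLeastAtMost mem_Collect_eq)

lemma insert_at_inject:
  assumes "insert_at i x v = insert_at j x w" "x \<notin> set v" "x \<notin> set w"
    "i \<le> length v" "j \<le> length w"
  shows "i = j \<and> v = w"
proof -
  have "take i v = take j w" "drop i v = drop j w"
    using assms unfolding insert_at_def
    by (metis append_Cons_eq_iff in_set_takeD in_set_dropD)+
  then show ?thesis
    using assms by (metis append_take_drop_id length_take min.absorb2)
qed

text \<open>
  A list over \<open>{1..Suc m}\<close> either avoids \<open>Suc m\<close> or arises from exactly one list over
  \<open>{1..m}\<close> by one insertion.
\<close>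

lemma sum_arrangements_Suc:
  fixes g :: "nat list \<Rightarrow> 'a :: comm_monoid_add"
  shows "(\<Sum>w\<in>arrangements (Suc m). g w) =
    (\<Sum>w\<in>arrangements m. g w + (\<Sum>j\<le>length w. g (insert_at j (Suc m) w)))"
proof -
  define ins where "ins = (\<lambda>(w, j). insert_at j (Suc m) w)"
  define P where "P = (SIGMA w:arrangements m. {..length w})"
  have inj: "inj_on ins P"
    by (auto simp: inj_on_def ins_def P_def arrangements_def dest!: insert_at_inject)
  have disj: "arrangements m \<inter> ins ` P = {}"
    by (auto simp: arrangements_def ins_def insert_at_def)
  have "ins p \<in> arrangements (Suc m)" if p_in: "p \<in> P" for p
  proof -
    obtain w j where p: "p = (w, j)" "w \<in> arrangements m"
      using p_in unfolding P_def by blast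
    then show ?thesis
      by (auto simp: arrangements_def ins_def set_insert_at distinct_insert_at)
  qed
  moreover have "u \<in> ins ` P" if u: "u \<in> arrangements (Suc m)" "u \<notin> arrangements m" for u
  proof -
    have "Suc m \<in> set u"
      using u by (auto simp: arrangements_def subset_iff le_Suc_eq)
    then obtain ys zs where "u = ys @ Suc m # zs"
      by (meson split_list)
    then have "u = ins (ys @ zs, length ys)" "(ys @ zs, length ys) \<in> P"
      using u by (auto simp: ins_def insert_at_def P_def arrangements_def subset_iff le_Suc_eq)
    then show ?thesis by blast
  qed
  moreover have "arrangements m \<subseteq> arrangements (Suc m)"
    by (auto simp: arrangements_def)
  ultimately have "arrangements (Suc m) = arrangements m \<union> ins ` P"
    by blast
  moreover have "finite P" by (simp add: P_def)
  ultimately have "sum g (arrangements (Suc m)) = sum g (arrangements m) + sum (g \<circ> ins) P"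
    using disj inj by (simp add: sum.union_disjoint sum.reindex)
  also have "sum (g \<circ> ins) P = (\<Sum>w\<in>arrangements m. \<Sum>j\<le>length w. g (insert_at j (Suc m) w))"
    unfolding P_def by (simp add: sum.Sigma ins_def case_prod_unfold)
  finally show ?thesis by (simp add: sum.distrib)
qed

text \<open>
  The product of the values of \<open>- c\<close> on the edge directions at the vertex of \<open>w\<close>.
\<close>

definition vertex_denominator :: "(nat \<Rightarrow> real) \<Rightarrow> nat \<Rightarrow> nat list \<Rightarrow> real" where
  "vertex_denominator c n w = chain_prod (map c w) * (\<Prod>i\<in>{1..n} - set w. - c i)"

definition vertex_sum :: "(nat \<Rightarrow> real) \<Rightarrow> nat \<Rightarrow> (nat \<Rightarrow> real) \<Rightarrow> nat \<Rightarrow> real \<Rightarrow> real" where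
  "vertex_sum c n \<alpha> p a = (\<Sum>w\<in>arrangements n.
     (a + pairing \<alpha> (map c w)) ^ (p + n) / fact (p + n) / vertex_denominator c n w)"

text \<open>
  This is the algebraic half of the induction step. The term \<open>f j w\<close> is the value that the list
  \<open>w\<close> with \<open>Suc m\<close> inserted at position \<open>j\<close> contributes. The differences on the right come
  from integrating over the interval between \<open>\<alpha> (Suc (Suc j))\<close> and \<open>\<alpha> (Suc j)\<close>. Summation
  by parts collects the two occurrences of each \<open>f j w\<close>; the boundary term
  \<open>f (Suc m) w\<close>, where the new coordinate is 0, accounts for \<open>w\<close> itself.
\<close>

lemma vertex_sum_Suc:
  fixes c \<alpha> :: "nat \<Rightarrow> real" and a :: real and p m :: nat
  assumes c: "\<And>i. i \<in> {1..Suc m} \<Longrightarrow> 0 < c i" "inj_on c {1..Suc m}"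
    and zero: "\<alpha> (Suc (Suc m)) = 0"
  defines "f \<equiv> \<lambda>j w. (a + c (Suc m) * \<alpha> (Suc j) + pairing (skip j \<alpha>) (map c w)) ^ (p + Suc m)
      / fact (p + Suc m)"
  shows "vertex_sum c (Suc m) \<alpha> p a =
    (\<Sum>w\<in>arrangements m. (\<Sum>j\<le>m. (f j w - f (Suc j) w)
        * (1 / (c (Suc m) - nth_default 0 (map c w) j))) / vertex_denominator c m w)"
  unfolding vertex_sum_def sum_arrangements_Suc
proof (rule sum.cong[OF refl])
  fix w assume w: "w \<in> arrangements m"
  let ?vs = "map c w" and ?C = "c (Suc m)"
  let ?g = "\<lambda>w. (a + pairing \<alpha> (map c w)) ^ (p + Suc m) / fact (p + Suc m)
    / vertex_denominator c (Suc m) w"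
  define q where "q j = 1 / (?C - nth_default 0 ?vs j)" for j
  have len: "length w \<le> m" using w by (rule length_arrangement)
  have sub: "set w \<subseteq> {1..m}" and dist: "distinct w"
    using w by (auto simp: arrangements_def)
  have vs: "distinct (?C # ?vs)" "0 \<notin> set (?C # ?vs)"
  proof -
    have "inj_on c (set (Suc m # w))"
      using sub by (intro inj_on_subset[OF c(2)]) auto
    moreover have "distinct (Suc m # w)"
      using sub dist by auto
    ultimately have "distinct (map c (Suc m # w))"
      unfolding distinct_map by blast
    then show "distinct (?C # ?vs)" by simp
    show "0 \<notin> set (?C # ?vs)" using c(1) sub by force
  qed
  have cz: "chain_prod ?vs \<noteq> 0" using vs by (intro chain_prod_nonzero) auto
  have inner: "?g (insert_at j (Suc m) w)
      = f j w * (if j = 0 then q 0 else q j - q (j - 1)) / vertex_denominator c m w"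
    if j: "j \<le> length w" for j
  proof -
    have m: "map c (insert_at j (Suc m) w) = insert_at j ?C ?vs"
      by (simp add: insert_at_def take_map drop_map)
    have "{1..Suc m} - set (insert_at j (Suc m) w) = {1..Suc m} - insert (Suc m) (set w)"
      by (simp add: set_insert_at)
    also have "\<dots> = {1..m} - set w"
      using sub by (simp add: atLeastAtMostSuc_conv insert_Diff_if Diff_insert0)
    finally have "{1..Suc m} - set (insert_at j (Suc m) w) = {1..m} - set w" .
    moreover have "1 / chain_prod (insert_at j ?C ?vs)
        = (if j = 0 then q 0 else q j - q (j - 1)) / chain_prod ?vs"
      unfolding q_def using chain_prod_insert_at[OF vs, of j] j cz
      by (simp add: field_simps del: chain_prod_Nil)
    ultimately have "1 / vertex_denominator c (Suc m) (insert_at j (Suc m) w)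
        = (if j = 0 then q 0 else q j - q (j - 1)) / vertex_denominator c m w"
      unfolding vertex_denominator_def m by (metis divide_divide_eq_left)
    moreover have "a + pairing \<alpha> (map c (insert_at j (Suc m) w))
        = a + ?C * \<alpha> (Suc j) + pairing (skip j \<alpha>) ?vs"
      using j by (simp add: m pairing_insert_at)
    ultimately show ?thesis
      unfolding f_def by (metis mult.right_neutral times_divide_eq_right)
  qed
  have last: "?g w = - (f (Suc m) w * q m) / vertex_denominator c m w"
  proof -
    have "{1..Suc m} - set w = insert (Suc m) ({1..m} - set w)" using sub by auto
    then have "vertex_denominator c (Suc m) w = - ?C * vertex_denominator c m w"
      by (simp add: vertex_denominator_def)
    moreover have "pairing (skip (Suc m) \<alpha>) ?vs = pairing \<alpha> ?vs"
      using len by (intro pairing_cong) (auto simp: skip_def)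
    then have "f (Suc m) w = (a + pairing \<alpha> ?vs) ^ (p + Suc m) / fact (p + Suc m)"
      by (simp add: f_def zero)
    moreover have "q m = 1 / ?C" using len by (simp add: q_def nth_default_def)
    ultimately show ?thesis by simp
  qed
  \<comment> \<open>Beyond the end of \<open>w\<close> the coefficients \<open>q j\<close> are all \<open>1 / c (Suc m)\<close>: insertion
     behind the end with a gap is no vertex, and its two contributions cancel.\<close>
  have "(\<Sum>j\<le>m. f j w * (if j = 0 then q 0 else q j - q (j - 1)))
      = (\<Sum>j\<le>length w. f j w * (if j = 0 then q 0 else q j - q (j - 1)))"
  proof (rule sum.mono_neutral_right)
    show "\<forall>j\<in>{..m} - {..length w}. f j w * (if j = 0 then q 0 else q j - q (j - 1)) = 0"
      by (auto simp: q_def nth_default_def)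
  qed (use len in auto)
  then have "(\<Sum>j\<le>m. (f j w - f (Suc j) w) * q j)
    = (\<Sum>j\<le>length w. f j w * (if j = 0 then q 0 else q j - q (j - 1))) - f (Suc m) w * q m"
    by (simp only: summation_by_parts[of "\<lambda>j. f j w"])
  moreover have "(\<Sum>j\<le>length w. ?g (insert_at j (Suc m) w)) =
    (\<Sum>j\<le>length w. f j w * (if j = 0 then q 0 else q j - q (j - 1))) / vertex_denominator c m w"
    unfolding sum_divide_distrib by (intro sum.cong refl inner) simp
  ultimately show "?g w + (\<Sum>j\<le>length w. ?g (insert_at j (Suc m) w)) =
    (\<Sum>j\<le>m. (f j w - f (Suc j) w) * (1 / (?C - nth_default 0 ?vs j))) / vertex_denominator c m w"
    unfolding q_def[symmetric] last by (simp add: diff_divide_distrib)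
qed

section \<open>Slices of the body\<close>

lemma sim_body_iff:
  "x \<in> sim_body n \<alpha> \<longleftrightarrow>
    x \<in> {1..n} \<rightarrow>\<^sub>E {0..} \<and> (\<forall>I\<in>Pow {1..n}. sum x I \<le> sum \<alpha> {1..card I})"
proof -
  have "sum x I \<le> sum \<alpha> {1..card I}"
    if "\<forall>k\<ge>1. \<forall>I\<in>nsets {1..n} k. sum x I \<le> (\<Sum>i=1..k. \<alpha> i)" "I \<subseteq> {1..n}" for I
  proof (cases "I = {}")
    case False
    have "finite I" using that(2) by (rule finite_subset) simp
    with False have "1 \<le> card I" by (simp add: Suc_le_eq card_gt_0_iff)
    with that \<open>finite I\<close> show ?thesis by (simp add: nsets_def)
  qed simp
  then show ?thesis
    unfolding sim_body_def by (auto simp: nsets_def)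
qed

lemma sim_body_cong:
  assumes "\<And>i. i \<in> {1..n} \<Longrightarrow> \<alpha> i = \<beta> i"
  shows "sim_body n \<alpha> = sim_body n \<beta>"
proof -
  have "sum \<alpha> {1..card I} = sum \<beta> {1..card I}" if "I \<in> Pow {1..n}" for I
    using assms card_mono[of "{1..n}" I] that by (intro sum.cong) auto
  then show ?thesis by (auto simp: sim_body_iff)
qed

lemma measurable_sim_body [measurable]: "sim_body n \<alpha> \<in> sets (lebesgue_n n)"
proof -
  have "sim_body n \<alpha> = {x \<in> space (lebesgue_n n).
      (\<forall>i\<in>{1..n}. 0 \<le> x i) \<and> (\<forall>I\<in>Pow {1..n}. sum x I \<le> sum \<alpha> {1..card I})}"
    by (auto simp: sim_body_iff space_PiM PiE_def Pi_def)
  also have "\<dots> \<in> sets (lebesgue_n n)"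
  proof (intro sets.sets_Collect_conj sets.sets_Collect_finite_All)
    fix i assume "i \<in> {1..n}"
    then have "(\<lambda>x. x i) \<in> borel_measurable (lebesgue_n n)"
      using measurable_component_singleton[of i "{1..n}" "\<lambda>_. lborel :: real measure"] by simp
    then show "{x \<in> space (lebesgue_n n). 0 \<le> x i} \<in> sets (lebesgue_n n)"
      by measurable
  next
    fix I assume "I \<in> Pow {1..n}"
    then have "(\<lambda>x. sum x I) \<in> borel_measurable (lebesgue_n n)"
      by (intro borel_measurable_sum measurable_component_singleton[THEN measurable_compose]) auto
    then show "{x \<in> space (lebesgue_n n). sum x I \<le> sum \<alpha> {1..card I}} \<in> sets (lebesgue_n n)"
      by measurable
  qed auto
  finally show ?thesis .
qed

text \<open>
  The neighbours \<open>\<alpha> (Suc j)\<close> and \<open>\<alpha> (Suc (Suc j))\<close> of \<open>t\<close> are replaced by one parameter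
  in such a way that their sum decreases by \<open>t\<close>.
\<close>

definition slice_params :: "nat \<Rightarrow> real \<Rightarrow> (nat \<Rightarrow> real) \<Rightarrow> nat \<Rightarrow> real" where
  "slice_params j t \<alpha> = (skip j \<alpha>)(Suc j := \<alpha> (Suc j) + \<alpha> (Suc (Suc j)) - t)"

lemma sum_slice_params:
  "sum (slice_params j t \<alpha>) {1..k} =
    (if k \<le> j then sum \<alpha> {1..k} else sum \<alpha> {1..Suc k} - t)"
proof (induction k)
  case (Suc k)
  consider "Suc k \<le> j" | "k = j" | "k > j" by linarith
  then show ?case
    by cases (use Suc in \<open>auto simp: slice_params_def skip_def\<close>)
qed simp

text \<open>
  For a set \<open>I\<close> of \<open>k\<close> coordinates other than the last, the body imposes the bound
  \<open>\<alpha>\<^sub>1 + \<dots> + \<alpha>\<^sub>k\<close> through \<open>I\<close> and the bound \<open>\<alpha>\<^sub>1 + \<dots> + \<alpha>\<^sub>k\<^sub>+\<^sub>1 - t\<close> through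
  \<open>I\<close> together with the last coordinate. Comparing \<open>\<alpha>\<^sub>k\<^sub>+\<^sub>1\<close> with \<open>t\<close> tells which one is
  sharper, and the sharper bounds are the partial sums of the new parameters.
\<close>

lemma sim_body_slice:
  fixes \<alpha> :: "nat \<Rightarrow> real"
  assumes dec: "decseq (\<lambda>i. \<alpha> (Suc i))" and zero: "\<alpha> (Suc (Suc m)) = 0"
    and j: "j \<le> m" and t: "t \<in> {\<alpha> (Suc (Suc j))..\<alpha> (Suc j)}"
    and x: "x \<in> extensional {1..m}"
  shows "x(Suc m := t) \<in> sim_body (Suc m) \<alpha> \<longleftrightarrow> x \<in> sim_body m (slice_params j t \<alpha>)"
proof -
  let ?y = "x(Suc m := t)"
  define A where "A k = sum \<alpha> {1..k}" for k
  have A_Suc: "A (Suc k) = A k + \<alpha> (Suc k)" for k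
    by (simp add: A_def)
  have \<alpha>_le: "\<alpha> (Suc k) \<le> \<alpha> (Suc i)" if "i \<le> k" for i k
    using decseqD[OF dec that] .
  have t0: "0 \<le> t"
    using \<alpha>_le[of "Suc j" "Suc m"] j t zero by simp
  have Pow_split: "(\<forall>I\<in>Pow {1..Suc m}. P I) \<longleftrightarrow>
      (\<forall>I\<in>Pow {1..m}. P I \<and> P (insert (Suc m) I))" for P
    by (simp add: atLeastAtMostSuc_conv Pow_insert ball_Un del: Pow_iff) blast
  have PiE: "?y \<in> {1..Suc m} \<rightarrow>\<^sub>E {0..} \<longleftrightarrow> x \<in> {1..m} \<rightarrow>\<^sub>E {0..}"
    using x t0 by (auto simp: PiE_def Pi_def extensional_def le_Suc_eq)
  have "sum ?y I \<le> A (card I) \<and> sum ?y (insert (Suc m) I) \<le> A (card (insert (Suc m) I))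
      \<longleftrightarrow> sum x I \<le> sum (slice_params j t \<alpha>) {1..card I}" if I: "I \<in> Pow {1..m}" for I
  proof -
    have fin: "finite I" and notin: "Suc m \<notin> I"
      using I finite_subset[of I "{1..m}"] by auto
    have "sum ?y I = sum x I"
      using notin by (intro sum.cong) auto
    moreover have "sum ?y (insert (Suc m) I) = sum x I + t"
      using fin notin calculation by simp
    moreover have "card (insert (Suc m) I) = Suc (card I)"
      using fin notin by simp
    moreover have "\<alpha> (Suc j) \<le> \<alpha> (Suc (card I))" if "card I \<le> j"
      using \<alpha>_le that by blast
    moreover have "\<alpha> (Suc (card I)) \<le> \<alpha> (Suc (Suc j))" if "\<not> card I \<le> j"
      using \<alpha>_le[of "Suc j" "card I"] that by simp
    ultimately show ?thesis
      using t unfolding sum_slice_params A_def[symmetric] by (auto simp: A_Suc)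
  qed
  then show ?thesis
    unfolding sim_body_iff PiE Pow_split A_def by blast
qed

lemma sim_body_slice_bounds:
  assumes "x(Suc m := t) \<in> sim_body (Suc m) \<alpha>"
  shows "t \<in> {0..\<alpha> 1}"
proof -
  have pos: "(x(Suc m := t)) \<in> {1..Suc m} \<rightarrow>\<^sub>E {0..}"
    and "\<forall>I\<in>Pow {1..Suc m}. sum (x(Suc m := t)) I \<le> sum \<alpha> {1..card I}"
    using assms unfolding sim_body_iff by blast+
  from this(2) have "sum (x(Suc m := t)) {Suc m} \<le> sum \<alpha> {1..card {Suc m}}"
    by (rule bspec) simp
  then show ?thesis
    using PiE_mem[OF pos, of "Suc m"] by simp
qed

section \<open>Integration over the body\<close>

text \<open>
  Consecutive intervals share an endpoint, at which their integrands may be described by different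
  functions; such a point has measure 0.
\<close>

lemma nn_integral_piecewise_FTC:
  fixes F G :: "nat \<Rightarrow> real \<Rightarrow> real" and s :: "nat \<Rightarrow> real" and h :: "real \<Rightarrow> ennreal"
  assumes h [measurable]: "h \<in> borel_measurable borel"
    and G [measurable]: "\<And>j. G j \<in> borel_measurable borel"
    and s: "decseq s"
    and F: "\<And>j t. j < N \<Longrightarrow> t \<in> {s (Suc j)..s j} \<Longrightarrow> (F j has_real_derivative G j t) (at t)"
    and G_nonneg: "\<And>j t. j < N \<Longrightarrow> t \<in> {s (Suc j)..s j} \<Longrightarrow> 0 \<le> G j t"
    and hG: "\<And>j t. j < N \<Longrightarrow> t \<in> {s (Suc j)..s j} \<Longrightarrow> h t = ennreal (G j t)"
  shows "0 \<le> (\<Sum>j<N. F j (s j) - F j (s (Suc j))) \<and>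
    (\<integral>\<^sup>+t. h t * indicator {s N..s 0} t \<partial>lborel) = ennreal (\<Sum>j<N. F j (s j) - F j (s (Suc j)))"
  using F G_nonneg hG
proof (induction N)
  case 0
  have "AE t in lborel. h t * indicator {s 0..s 0} t = 0"
    using AE_lborel_singleton[of "s 0"] by eventually_elim auto
  then show ?case by (simp add: nn_integral_0_iff_AE)
next
  case (Suc N)
  let ?S = "\<Sum>j<N. F j (s j) - F j (s (Suc j))" and ?D = "F N (s N) - F N (s (Suc N))"
  have le: "s (Suc N) \<le> s N" "s N \<le> s 0" using s by (auto intro: decseqD)
  have D: "0 \<le> ?D"
    using DERIV_nonneg_imp_nondecreasing[of "s (Suc N)" "s N" "F N"] le(1) Suc.prems(1,2)[of N]
    by (metis atLeastAtMost_iff diff_ge_0_iff_ge lessI)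
  have IH: "0 \<le> ?S" "(\<integral>\<^sup>+t. h t * indicator {s N..s 0} t \<partial>lborel) = ennreal ?S"
    using Suc.IH Suc.prems by (metis less_SucI)+
  have "(\<integral>\<^sup>+t. h t * indicator {s (Suc N)..s N} t \<partial>lborel)
      = (\<integral>\<^sup>+t. ennreal (G N t) * indicator {s (Suc N)..s N} t \<partial>lborel)"
    by (intro nn_integral_cong) (auto simp: Suc.prems(3) split: split_indicator)
  also have "\<dots> = ennreal ?D"
    using le(1) Suc.prems(1,2)[of N] by (intro nn_integral_FTC_Icc) auto
  finally have last: "(\<integral>\<^sup>+t. h t * indicator {s (Suc N)..s N} t \<partial>lborel) = ennreal ?D" .
  have "AE t in lborel. h t * indicator {s (Suc N)..s 0} t
      = h t * indicator {s N..s 0} t + h t * indicator {s (Suc N)..s N} t"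
    using AE_lborel_singleton[of "s N"]
    by eventually_elim (use le in \<open>auto split: split_indicator\<close>)
  then have "(\<integral>\<^sup>+t. h t * indicator {s (Suc N)..s 0} t \<partial>lborel)
      = (\<integral>\<^sup>+t. h t * indicator {s N..s 0} t + h t * indicator {s (Suc N)..s N} t \<partial>lborel)"
    by (rule nn_integral_cong_AE)
  also have "\<dots> = ennreal ?S + ennreal ?D"
    by (subst nn_integral_add) (simp_all add: IH last)
  also have "\<dots> = ennreal (?S + ?D)"
    using IH(1) D by simp
  finally show ?case using IH(1) D by simp
qed

lemma vertex_sum_cong:
  assumes "\<And>i. i \<in> {1..n} \<Longrightarrow> \<alpha> i = \<beta> i"
  shows "vertex_sum c n \<alpha> p a = vertex_sum c n \<beta> p a"
proof -
  have "pairing \<alpha> (map c w) = pairing \<beta> (map c w)" if "w \<in> arrangements n" for w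
    using length_arrangement[OF that] assms by (intro pairing_cong) auto
  then show ?thesis unfolding vertex_sum_def by (intro sum.cong) auto
qed

text \<open>
  At both ends of its range, \<open>t\<close> equals a parameter, and the slice has the remaining
  parameters of \<open>\<alpha>\<close>: the lower end of one interval and the upper end of the next agree.
\<close>

lemma slice_params_upper: "slice_params j (\<alpha> (Suc j)) \<alpha> = skip j \<alpha>"
  by (auto simp: slice_params_def skip_def)

lemma slice_params_lower: "slice_params j (\<alpha> (Suc (Suc j))) \<alpha> = skip (Suc j) \<alpha>"
  by (auto simp: slice_params_def skip_def fun_eq_iff le_Suc_eq)

lemma pairing_slice_params:
  "pairing (slice_params j t \<alpha>) vs
    = pairing (skip j \<alpha>) vs + nth_default 0 vs j * (\<alpha> (Suc j) - t)"
  unfolding slice_params_def pairing_fun_upd by (simp add: skip_def)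

text \<open>
  This is Brion's identity for the body. Positivity and injectivity of the weights make the
  linear form nonconstant on every edge; positivity, together with \<open>0 \<le> a\<close>, also keeps the
  integrand nonnegative, so that Tonelli's theorem applies without integrability conditions.
  Nonnegativity of the vertex sum is part of the claim because \<open>ennreal\<close> truncates negative
  numbers.
\<close>

lemma nn_integral_linear_power_sim_body:
  fixes c \<alpha> :: "nat \<Rightarrow> real"
  assumes "\<And>i. i \<in> {1..n} \<Longrightarrow> 0 < c i" "inj_on c {1..n}"
    and "\<And>i. i \<in> {1..n} \<Longrightarrow> 0 \<le> \<alpha> i" "\<And>i. i \<in> {1..<n} \<Longrightarrow> \<alpha> (Suc i) \<le> \<alpha> i"
    and "0 \<le> a"
  shows "0 \<le> vertex_sum c n \<alpha> p a \<and>
    (\<integral>\<^sup>+x. ennreal ((a + (\<Sum>i\<in>{1..n}. c i * x i)) ^ p / fact p) * indicator (sim_body n \<alpha>) x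
      \<partial>lebesgue_n n) = ennreal (vertex_sum c n \<alpha> p a)"
  using assms
proof (induction n arbitrary: \<alpha> a)
  case 0
  interpret product_sigma_finite "\<lambda>_::nat. lborel :: real measure" by standard
  have "(\<lambda>_. undefined) \<in> sim_body 0 \<alpha>"
    by (auto simp: sim_body_iff)
  with 0 show ?case
    by (simp add: nn_integral_empty vertex_sum_def vertex_denominator_def)
next
  case (Suc m)
  interpret product_sigma_finite "\<lambda>_::nat. lborel :: real measure" by standard
  \<comment> \<open>The slices of the lowest interval need \<open>\<alpha> (Suc (Suc m)) = 0\<close>, so the parameters are
     cut off behind \<open>Suc m\<close>; neither side of the identity sees the change.\<close>
  define \<beta> where "\<beta> i = (if i \<le> Suc m then \<alpha> i else 0)" for i
  have \<beta>_eq: "\<beta> i = \<alpha> i" if "i \<in> {1..Suc m}" for i using that by (simp add: \<beta>_def)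
  have zero: "\<beta> (Suc (Suc m)) = 0" by (simp add: \<beta>_def)
  have dec: "decseq (\<lambda>i. \<beta> (Suc i))"
    unfolding decseq_Suc_iff \<beta>_def using Suc.prems(3,4) by simp
  have \<beta>_nonneg: "0 \<le> \<beta> (Suc i)" for i
    unfolding \<beta>_def using Suc.prems(3) by simp
  let ?C = "c (Suc m)"
  have C: "0 < ?C" using Suc.prems(1) by simp
  have c: "\<And>i. i \<in> {1..m} \<Longrightarrow> 0 < c i" "inj_on c {1..m}"
    using Suc.prems(1,2) by (auto elim!: inj_on_subset)
  \<comment> \<open>The integral over the slice at \<open>t\<close> is \<open>h t\<close>; on the \<open>j\<close>-th interval the
     induction hypothesis evaluates it to \<open>G j t\<close>, with antiderivative \<open>F j\<close>.\<close>
  define h where "h t = (\<integral>\<^sup>+x. ennreal ((a + (\<Sum>i\<in>{1..Suc m}. c i * (x(Suc m := t)) i)) ^ p / fact p)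
      * indicator (sim_body (Suc m) \<beta>) (x(Suc m := t)) \<partial>lebesgue_n m)" for t
  define G where "G j t = vertex_sum c m (slice_params j t \<beta>) p (a + ?C * t)" for j t
  define F where "F j t = (\<Sum>w\<in>arrangements m.
      (a + ?C * t + pairing (slice_params j t \<beta>) (map c w)) ^ (p + Suc m) / fact (p + Suc m)
      * (1 / (?C - nth_default 0 (map c w) j)) / vertex_denominator c m w)" for j t
  have slice: "0 \<le> G j t \<and> h t = ennreal (G j t)"
    if j: "j < Suc m" and t: "t \<in> {\<beta> (Suc (Suc j))..\<beta> (Suc j)}" for j t
  proof -
    have t0: "0 \<le> t" using t \<beta>_nonneg[of "Suc j"] by simp
    have \<beta>_le: "\<beta> (Suc k) \<le> \<beta> (Suc i)" if "i \<le> k" for i k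
      using decseqD[OF dec that] .
    have nonneg: "0 \<le> slice_params j t \<beta> i" if "i \<in> {1..m}" for i
      using t \<beta>_nonneg[of "i - 1"] \<beta>_nonneg[of i] \<beta>_nonneg[of "Suc j"] that
      by (auto simp: slice_params_def skip_def)
    have "slice_params j t \<beta> (Suc i) \<le> slice_params j t \<beta> i" if "i \<in> {1..<m}" for i
      using t \<beta>_le[of "i - 1" i] \<beta>_le[of i "Suc i"] that
      by (auto simp: slice_params_def skip_def)
    with nonneg have IH: "0 \<le> G j t"
      "(\<integral>\<^sup>+x. ennreal ((a + ?C * t + (\<Sum>i\<in>{1..m}. c i * x i)) ^ p / fact p)
        * indicator (sim_body m (slice_params j t \<beta>)) x \<partial>lebesgue_n m) = ennreal (G j t)"
      unfolding G_def using Suc.IH[of "slice_params j t \<beta>" "a + ?C * t"] c t0 C Suc.prems(5)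
      by auto
    have "h t = (\<integral>\<^sup>+x. ennreal ((a + ?C * t + (\<Sum>i\<in>{1..m}. c i * x i)) ^ p / fact p)
        * indicator (sim_body m (slice_params j t \<beta>)) x \<partial>lebesgue_n m)"
      unfolding h_def
    proof (rule nn_integral_cong)
      fix x assume "x \<in> space (lebesgue_n m)"
      then have "x \<in> extensional {1..m}" by (simp add: space_PiM PiE_def)
      then have "x(Suc m := t) \<in> sim_body (Suc m) \<beta> \<longleftrightarrow> x \<in> sim_body m (slice_params j t \<beta>)"
        using j t by (intro sim_body_slice dec zero) auto
      moreover have "(\<Sum>i\<in>{1..Suc m}. c i * (x(Suc m := t)) i)
          = ?C * t + (\<Sum>i\<in>{1..m}. c i * x i)"
      proof -
        have "(\<Sum>i\<in>{1..m}. c i * (x(Suc m := t)) i) = (\<Sum>i\<in>{1..m}. c i * x i)"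
          by (intro sum.cong) auto
        then show ?thesis by simp
      qed
      ultimately show "ennreal ((a + (\<Sum>i\<in>{1..Suc m}. c i * (x(Suc m := t)) i)) ^ p / fact p)
          * indicator (sim_body (Suc m) \<beta>) (x(Suc m := t))
        = ennreal ((a + ?C * t + (\<Sum>i\<in>{1..m}. c i * x i)) ^ p / fact p)
          * indicator (sim_body m (slice_params j t \<beta>)) x"
        by (simp add: add_ac indicator_def)
    qed
    with IH show ?thesis by simp
  qed
  have deriv: "(F j has_real_derivative G j t) (at t)" for j t
  proof -
    have "((\<lambda>t. (a + ?C * t + pairing (slice_params j t \<beta>) (map c w)) ^ (p + Suc m)
        / fact (p + Suc m) * (1 / (?C - nth_default 0 (map c w) j)) / vertex_denominator c m w)
      has_real_derivative (a + ?C * t + pairing (slice_params j t \<beta>) (map c w)) ^ (p + m)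
        / fact (p + m) / vertex_denominator c m w) (at t)"
      if w: "w \<in> arrangements m" for w
    proof -
      have "?C \<noteq> nth_default 0 (map c w) j"
      proof (cases "j < length w")
        case True
        then have "w ! j \<in> {1..m}"
          using w nth_mem[OF True] unfolding arrangements_def by blast
        then have "?C \<noteq> c (w ! j)"
          using inj_onD[OF Suc.prems(2), of "Suc m" "w ! j"] by auto
        with True show ?thesis by (simp add: nth_default_def)
      qed (use C in \<open>simp add: nth_default_def\<close>)
      then have ne: "?C - nth_default 0 (map c w) j \<noteq> 0" by simp
      have "((\<lambda>t. a + ?C * t + pairing (slice_params j t \<beta>) (map c w))
          has_real_derivative (?C - nth_default 0 (map c w) j)) (at t)"
        unfolding pairing_slice_params by (auto intro!: derivative_eq_intros)
      from DERIV_cmult[OF DERIV_power[OF this, of "Suc (p + m)"], of "1 / fact (Suc (p + m))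
          * (1 / (?C - nth_default 0 (map c w) j)) / vertex_denominator c m w"]
      show ?thesis
        by (rule DERIV_cong_ev[THEN iffD1, OF refl always_eventually, rotated -1])
          (use ne in \<open>auto simp: divide_simps simp del: of_nat_Suc power_Suc\<close>)
    qed
    then show ?thesis
      unfolding F_def G_def vertex_sum_def by (intro DERIV_sum)
  qed
  have G_meas: "G j \<in> borel_measurable borel" for j
    unfolding G_def vertex_sum_def pairing_slice_params by measurable
  have integrand [measurable]: "(\<lambda>x. ennreal ((a + (\<Sum>i\<in>{1..Suc m}. c i * x i)) ^ p / fact p)
      * indicator (sim_body (Suc m) \<beta>) x) \<in> borel_measurable (lebesgue_n (Suc m))"
    by measurable
  have ins: "{1..Suc m} = insert (Suc m) {1..m}" by auto
  have h_meas: "h \<in> borel_measurable borel"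
  proof -
    interpret sigma_finite_measure "lebesgue_n m"
      by (rule sigma_finite) simp
    have "(\<lambda>(t, x). x(Suc m := t))
        \<in> lborel \<Otimes>\<^sub>M lebesgue_n m \<rightarrow>\<^sub>M lebesgue_n (Suc m)"
      using measurable_compose[OF measurable_pair_swap'[of lborel "lebesgue_n m"]
          measurable_add_dim[where i = "Suc m" and I = "{1..m}" and M = "\<lambda>_. lborel"]]
      unfolding ins by (simp add: case_prod_unfold)
    from measurable_compose[OF this integrand] have "h \<in> borel_measurable lborel"
      unfolding h_def by (intro borel_measurable_nn_integral) (simp add: case_prod_unfold)
    then show ?thesis by simp
  qed
  have "0 \<le> (\<Sum>j<Suc m. F j (\<beta> (Suc j)) - F j (\<beta> (Suc (Suc j)))) \<and>
    (\<integral>\<^sup>+t. h t * indicator {\<beta> (Suc (Suc m))..\<beta> (Suc 0)} t \<partial>lborel)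
      = ennreal (\<Sum>j<Suc m. F j (\<beta> (Suc j)) - F j (\<beta> (Suc (Suc j))))"
    using slice deriv
    by (intro nn_integral_piecewise_FTC[where s = "\<lambda>i. \<beta> (Suc i)" and G = G] h_meas G_meas dec)
      blast+
  moreover have "(\<Sum>j<Suc m. F j (\<beta> (Suc j)) - F j (\<beta> (Suc (Suc j))))
      = vertex_sum c (Suc m) \<beta> p a"
  proof -
    define P where "P j w = (a + ?C * \<beta> (Suc j) + pairing (skip j \<beta>) (map c w)) ^ (p + Suc m)
      / fact (p + Suc m)" for j w
    have "(\<Sum>j<Suc m. F j (\<beta> (Suc j)) - F j (\<beta> (Suc (Suc j))))
        = (\<Sum>j\<le>m. \<Sum>w\<in>arrangements m. (P j w - P (Suc j) w)
          * (1 / (?C - nth_default 0 (map c w) j)) / vertex_denominator c m w)"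
      unfolding F_def slice_params_upper slice_params_lower P_def[symmetric]
        sum_subtractf[symmetric] lessThan_Suc_atMost
      by (simp only: left_diff_distrib diff_divide_distrib)
    also have "\<dots> = (\<Sum>w\<in>arrangements m. (\<Sum>j\<le>m. (P j w - P (Suc j) w)
        * (1 / (?C - nth_default 0 (map c w) j))) / vertex_denominator c m w)"
      unfolding sum_divide_distrib by (rule sum.swap)
    also have "\<dots> = vertex_sum c (Suc m) \<beta> p a"
      unfolding P_def using Suc.prems(1,2) zero by (intro vertex_sum_Suc[symmetric])
    finally show ?thesis .
  qed
  moreover have "(\<integral>\<^sup>+t. h t * indicator {\<beta> (Suc (Suc m))..\<beta> (Suc 0)} t \<partial>lborel)
      = (\<integral>\<^sup>+t. h t \<partial>lborel)"
  proof (rule nn_integral_cong)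
    fix t :: real
    have "h t = 0" if "t \<notin> {\<beta> (Suc (Suc m))..\<beta> (Suc 0)}"
    proof -
      have "x(Suc m := t) \<notin> sim_body (Suc m) \<beta>" for x
        using that sim_body_slice_bounds[of x m t \<beta>] zero by auto
      then show ?thesis by (simp add: h_def)
    qed
    then show "h t * indicator {\<beta> (Suc (Suc m))..\<beta> (Suc 0)} t = h t"
      by (auto split: split_indicator)
  qed
  moreover have "(\<integral>\<^sup>+x. ennreal ((a + (\<Sum>i\<in>{1..Suc m}. c i * x i)) ^ p / fact p)
      * indicator (sim_body (Suc m) \<beta>) x \<partial>lebesgue_n (Suc m)) = (\<integral>\<^sup>+t. h t \<partial>lborel)"
    unfolding h_def using integrand unfolding ins
    by (intro product_nn_integral_insert_rev) auto
  moreover have "sim_body (Suc m) \<beta> = sim_body (Suc m) \<alpha>"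
    "vertex_sum c (Suc m) \<beta> p a = vertex_sum c (Suc m) \<alpha> p a"
    using \<beta>_eq by (intro sim_body_cong vertex_sum_cong; blast)+
  ultimately show ?case by simp
qed

lemma measure_sim_body:
  fixes c \<alpha> :: "nat \<Rightarrow> real"
  assumes "\<And>i. i \<in> {1..n} \<Longrightarrow> 0 < c i" "inj_on c {1..n}"
    and "\<And>i. i \<in> {1..n} \<Longrightarrow> 0 \<le> \<alpha> i" "\<And>i. i \<in> {1..<n} \<Longrightarrow> \<alpha> (Suc i) \<le> \<alpha> i"
  shows "vol n (sim_body n \<alpha>) = vertex_sum c n \<alpha> 0 0"
  using nn_integral_linear_power_sim_body[where n = n and c = c and \<alpha> = \<alpha> and a = 0 and p = 0,
      OF assms] measurable_sim_body[of n \<alpha>]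
  by (simp add: measure_def)

section \<open>Arrangements as sorted sets with a permutation\<close>

lemma sum_arrangements_by_support:
  fixes g :: "nat list \<Rightarrow> 'a :: comm_monoid_add"
  shows "sum g (arrangements n)
    = g [] + (\<Sum>k\<in>{1..n}. \<Sum>L\<in>nsets {1..n} k. sum g (permutations_of_set L))"
proof -
  have fin: "finite L" if "L \<in> Pow {1..n}" for L
    using that by (auto intro: finite_subset)
  have "sum g (arrangements n)
      = (\<Sum>L\<in>Pow {1..n}. sum g {w \<in> arrangements n. set w = L})"
  proof (rule sum.group[symmetric])
    show "set ` arrangements n \<subseteq> Pow {1..n}"
      by (auto simp: arrangements_def)
  qed simp_all
  also have "\<dots> = (\<Sum>L\<in>Pow {1..n}. sum g (permutations_of_set L))"
    by (intro sum.cong refl arg_cong2[where f = sum])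
      (auto simp: arrangements_def permutations_of_set_def)
  also have "\<dots> = (\<Sum>k\<in>{0..n}. \<Sum>L\<in>{L \<in> Pow {1..n}. card L = k}. sum g (permutations_of_set L))"
  proof (rule sum.group[symmetric])
    show "card ` Pow {1..n} \<subseteq> {0..n}"
      using card_mono[of "{1..n}"] by auto
  qed auto
  also have "\<dots> = (\<Sum>k\<in>{0..n}. \<Sum>L\<in>nsets {1..n} k. sum g (permutations_of_set L))"
    by (intro sum.cong refl) (auto simp: nsets_def fin)
  also have "\<dots> = (\<Sum>L\<in>nsets {1..n} 0. sum g (permutations_of_set L))
      + (\<Sum>k\<in>{1..n}. \<Sum>L\<in>nsets {1..n} k. sum g (permutations_of_set L))"
    by (simp add: sum.atLeast_Suc_atMost)
  also have "nsets {1..n} 0 = {{}}"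
    by (auto simp: nsets_def)
  finally show ?thesis by simp
qed

definition permuted_list :: "(nat \<Rightarrow> nat) \<Rightarrow> nat set \<Rightarrow> nat list" where
  "permuted_list \<sigma> L = map (\<lambda>i. sorted_list_of_set L ! (\<sigma> i - 1)) [1..<Suc (card L)]"

lemma bij_betw_permuted_list:
  assumes L: "finite L"
  shows "bij_betw (\<lambda>\<sigma>. permuted_list \<sigma> L) {\<sigma>. \<sigma> permutes {1..card L}} (permutations_of_set L)"
proof -
  let ?xs = "sorted_list_of_set L" and ?k = "card L"
  let ?f = "\<lambda>\<sigma>. permuted_list \<sigma> L"
  have xs: "distinct ?xs" "set ?xs = L" "length ?xs = ?k"
    using L by auto
  have index: "?xs ! (\<sigma> i - 1) = ?xs ! (\<tau> j - 1) \<longleftrightarrow> \<sigma> i = \<tau> j"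
    if "\<sigma> permutes {1..?k}" "\<tau> permutes {1..?k}" "i \<in> {1..?k}" "j \<in> {1..?k}" for \<sigma> \<tau> i j
  proof -
    have "\<sigma> i \<in> {1..?k}" "\<tau> j \<in> {1..?k}"
      using that by (simp_all only: permutes_in_image)
    then show ?thesis
      using xs by (subst nth_eq_iff_index_eq) auto
  qed
  have inj: "inj_on ?f {\<sigma>. \<sigma> permutes {1..?k}}"
  proof (rule inj_onI)
    fix \<sigma> \<tau> assume \<sigma>: "\<sigma> \<in> {\<sigma>. \<sigma> permutes {1..?k}}" and \<tau>: "\<tau> \<in> {\<sigma>. \<sigma> permutes {1..?k}}"
      and eq: "?f \<sigma> = ?f \<tau>"
    show "\<sigma> = \<tau>"
    proof
      fix i
      show "\<sigma> i = \<tau> i"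
      proof (cases "i \<in> {1..?k}")
        case True
        then have "i \<in> set [1..<Suc ?k]" by auto
        with eq have "?xs ! (\<sigma> i - 1) = ?xs ! (\<tau> i - 1)"
          unfolding permuted_list_def map_eq_conv by blast
        then show ?thesis using index \<sigma> \<tau> True by blast
      next
        case False
        then show ?thesis using \<sigma> \<tau> by (simp add: permutes_not_in)
      qed
    qed
  qed
  have sub: "?f ` {\<sigma>. \<sigma> permutes {1..?k}} \<subseteq> permutations_of_set L"
  proof safe
    fix \<sigma> assume \<sigma>: "\<sigma> permutes {1..?k}"
    have "distinct (?f \<sigma>)"
      unfolding permuted_list_def distinct_map inj_on_def
      using index[OF \<sigma> \<sigma>] permutes_inj[OF \<sigma>] by (auto dest: injD)
    moreover have "set (?f \<sigma>) \<subseteq> L"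
    proof
      fix x assume "x \<in> set (?f \<sigma>)"
      then have "x \<in> (\<lambda>i. ?xs ! (\<sigma> i - 1)) ` {1..?k}"
        by (simp add: permuted_list_def atLeastLessThanSuc_atLeastAtMost del: upt_Suc)
      then obtain i where i: "i \<in> {1..?k}" "x = ?xs ! (\<sigma> i - 1)"
        by blast
      then have "\<sigma> i \<in> {1..?k}" using \<sigma> by (simp only: permutes_in_image)
      then have "\<sigma> i - 1 < length ?xs" using xs by auto
      from nth_mem[OF this] show "x \<in> L" using i xs by simp
    qed
    moreover have "length (?f \<sigma>) = ?k" by (simp add: permuted_list_def)
    ultimately have "set (?f \<sigma>) = L"
      using L by (metis card_subset_eq distinct_card)
    with \<open>distinct (?f \<sigma>)\<close> show "?f \<sigma> \<in> permutations_of_set L" by blast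
  qed
  \<comment> \<open>Both sides have \<open>card L\<close> factorial many elements, so injectivity suffices.\<close>
  have "card (?f ` {\<sigma>. \<sigma> permutes {1..?k}}) = card (permutations_of_set L)"
    using L inj by (simp add: card_image card_permutations)
  then show ?thesis
    using sub inj by (simp add: bij_betw_def card_subset_eq)
qed

lemma nth_permuted_list:
  "i < card L \<Longrightarrow> map real (permuted_list \<sigma> L) ! i = perm_vec \<sigma> L (Suc i)"
  by (simp add: permuted_list_def perm_vec_def del: upt_Suc)

lemma length_permuted_list [simp]: "length (permuted_list \<sigma> L) = card L"
  by (simp add: permuted_list_def)

lemma pairing_permuted_list:
  "pairing \<alpha> (map real (permuted_list \<sigma> L)) = (\<Sum>i\<in>{1..card L}. perm_vec \<sigma> L i * \<alpha> i)"
  unfolding pairing_def One_nat_def sum.atLeast1_atMost_eq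
  by (intro sum.cong) (simp_all add: nth_permuted_list del: nth_map)

lemma chain_prod_permuted_list:
  assumes "1 \<le> card L"
  shows "chain_prod (map real (permuted_list \<sigma> L)) = perm_vec \<sigma> L (card L)
    * (\<Prod>i\<in>{1..card L - 1}. perm_vec \<sigma> L i - perm_vec \<sigma> L (i + 1))"
proof -
  obtain m where m: "card L = Suc m" using assms by (cases "card L") auto
  show ?thesis
    unfolding chain_prod_def One_nat_def prod.atLeast1_atMost_eq
    by (simp add: m nth_permuted_list nth_default_def mult.commute del: nth_map)
qed

section \<open>The volume formula\<close>

theorem proposition34:
  fixes n :: nat and \<alpha> :: "nat \<Rightarrow> real"
  assumes "n \<ge> 1"
    and "\<forall>i\<in>{1..<n}. \<alpha> i \<ge> \<alpha> (Suc i)"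
    and "\<alpha> n \<ge> 0"
  shows "vol n (sim_body n \<alpha>) =
    1 / fact n *
    (\<Sum>k\<in>{1..n}. \<Sum>L\<in>nsets {1..n} k. \<Sum>\<sigma>\<in>{\<sigma>. \<sigma> permutes {1..k}}.
       (\<Sum>i\<in>{1..k}. perm_vec \<sigma> L i * \<alpha> i) ^ n /
       (perm_vec \<sigma> L k
        * (\<Prod>i\<in>{1..k - 1}. perm_vec \<sigma> L i - perm_vec \<sigma> L (i + 1))
        * (\<Prod>i\<in>{1..n} - L. - real i)))"
proof -
  have nonneg: "0 \<le> \<alpha> i" if "i \<in> {1..n}" for i
  proof -
    have "i \<le> n" "1 \<le> i" using that by auto
    then show ?thesis
    proof (induction rule: inc_induct)
      case base
      then show ?case using assms(3) by simp
    next
      case (step k)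
      then show ?case using assms(2) by (force dest: bspec[of _ _ k])
    qed
  qed
  define g where "g w = pairing \<alpha> (map real w) ^ n / vertex_denominator real n w" for w
  have "vol n (sim_body n \<alpha>) = vertex_sum real n \<alpha> 0 0"
    using assms nonneg by (intro measure_sim_body) auto
  also have "\<dots> = 1 / fact n * sum g (arrangements n)"
    unfolding vertex_sum_def sum_distrib_left
    by (intro sum.cong) (simp_all add: g_def field_simps)
  also have "sum g (arrangements n)
      = (\<Sum>k\<in>{1..n}. \<Sum>L\<in>nsets {1..n} k. sum g (permutations_of_set L))"
    unfolding sum_arrangements_by_support using assms(1) by (simp add: g_def)
  also have "\<dots> = (\<Sum>k\<in>{1..n}. \<Sum>L\<in>nsets {1..n} k. \<Sum>\<sigma>\<in>{\<sigma>. \<sigma> permutes {1..k}}.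
      (\<Sum>i\<in>{1..k}. perm_vec \<sigma> L i * \<alpha> i) ^ n /
       (perm_vec \<sigma> L k
        * (\<Prod>i\<in>{1..k - 1}. perm_vec \<sigma> L i - perm_vec \<sigma> L (i + 1))
        * (\<Prod>i\<in>{1..n} - L. - real i)))"
  proof (intro sum.cong refl)
    fix k L assume k: "k \<in> {1..n}" and "L \<in> nsets {1..n} k"
    then have L: "finite L" "card L = k" by (auto simp: nsets_def)
    have bij: "bij_betw (\<lambda>\<sigma>. permuted_list \<sigma> L) {\<sigma>. \<sigma> permutes {1..k}} (permutations_of_set L)"
      using bij_betw_permuted_list[OF L(1)] L(2) by simp
    have "sum g (permutations_of_set L)
        = (\<Sum>\<sigma>\<in>{\<sigma>. \<sigma> permutes {1..k}}. g (permuted_list \<sigma> L))"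
      by (rule sum.reindex_bij_betw[OF bij, symmetric])
    also have "\<dots> = (\<Sum>\<sigma>\<in>{\<sigma>. \<sigma> permutes {1..k}}. (\<Sum>i\<in>{1..k}. perm_vec \<sigma> L i * \<alpha> i) ^ n /
       (perm_vec \<sigma> L k
        * (\<Prod>i\<in>{1..k - 1}. perm_vec \<sigma> L i - perm_vec \<sigma> L (i + 1))
        * (\<Prod>i\<in>{1..n} - L. - real i)))"
    proof (intro sum.cong refl)
      fix \<sigma> assume "\<sigma> \<in> {\<sigma>. \<sigma> permutes {1..k}}"
      then have "set (permuted_list \<sigma> L) = L"
        using bij_betwE[OF bij] by (auto dest: permutations_of_setD)
      then show "g (permuted_list \<sigma> L) = (\<Sum>i\<in>{1..k}. perm_vec \<sigma> L i * \<alpha> i) ^ n /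
       (perm_vec \<sigma> L k
        * (\<Prod>i\<in>{1..k - 1}. perm_vec \<sigma> L i - perm_vec \<sigma> L (i + 1))
        * (\<Prod>i\<in>{1..n} - L. - real i))"
        using L(2) k unfolding g_def vertex_denominator_def
        by (simp add: pairing_permuted_list chain_prod_permuted_list)
    qed
    finally show "sum g (permutations_of_set L) = \<dots>" .
  qed
  finally show ?thesis .
qed

end
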